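(* Let $x>0$ be a real number that is not an integer and let $\underline{\hat p}(x)$ be the corresponding mixed threshold joining strategy. Then $$\underline{\hat p}(x)\in\hat\Omega_{TH}\quad\text{if and only if}\quad W\left(\lfloor x\rfloor,\lfloor x\rfloor+1;\underline{\hat p}(x)\right)=\tilde R .$$
   Context: Model. Customers arrive at a single-server first-come-first-served queue according to a Poisson process with rate $\lambda>0$. When $n\ge 1$ customers are in the system, service is provided at exponential rate $\mu_n$, where $0<\mu_1\le\mu_2\le\cdots$ and $\lim_{n\to\infty}\mu_n=M<\infty$. Each arriving customer observes the number of customers present and either joins or balks. A joining customer receives a reward $R\ge0$ at service completion and pays $C>0$ per unit of time in the system, with no reneging. Let $\tilde R=R/C$. A strategy is a vector $\underline p=(p_0,p_1,\dots)\in[0,1]^\infty$, where $p_n$ is the probability that a customer who finds $n$ customers upon arrival joins. Let $n_0(\underline p)=\min\{n:p_n=0\}$. Mixed threshold strategy $\underline{\hat p}(x)$: with $n_0=\lfloor x\rfloor+1$, set $p_n=1$ for $n\le n_0-2$, $p_{\lfloor x\rfloor}=x-\lfloor x\rfloor\in(0,1)$, and $p_n=0$ for $n\ge n_0$. Delay function. For $0\le n<m$, $W(n,m;\underline p)$ is the expected remaining sojourn time of a tagged customer in the system who has $n$ customers in front of her when there are $m$ customers in total (including her), when all future arrivals follow $\underline p$. That is, it is the expected time until departure of the continuous-time Markov chain started at $(n,m)$ with transitions $(i,k)\to(i,k+1)$ at rate $\lambda p_k$, $(i,k)\to(i-1,k-1)$ at rate $\mu_k$ if $i\ge1$, and $(0,k)\to$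 departure at rate $\mu_k$. $W(n;\underline p)=W(n,n+1;\underline p)$ is the expected sojourn time of a customer who finds $n$ customers upon arrival and joins. Recurrent-class equilibria. A strategy $\underline p$ with $n_0(\underline p)<\infty$ is a recurrent-class equilibrium if, for every $n\le n_0(\underline p)$: $\tilde R-W(n;\underline p)\le0$ if $p_n=0$; $\tilde R-W(n;\underline p)\ge0$ if $p_n=1$; and $\tilde R-W(n;\underline p)=0$ if $p_n\in(0,1)$. $\hat\Omega_{TH}$ is the set of mixed threshold strategies that are recurrent-class equilibria. *)

theory Defs
  imports "HOL-Probability.Probability"
begin

text \<open>
  Parameters: \<open>lam\<close> is the arrival rate, \<open>mu k\<close> the total service rate when \<open>k \<ge> 1\<close> customers are
  present (\<open>mu 0\<close> is never used), and \<open>p n\<close> the probability of joining when \<open>n\<close> customers are found.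
\<close>

definition strategy :: "(nat \<Rightarrow> real) \<Rightarrow> bool" where
  "strategy p \<longleftrightarrow> (\<forall>n. 0 \<le> p n \<and> p n \<le> 1)"

text \<open>Only meaningful if some \<open>p n\<close> is zero.\<close>

definition first_balk :: "(nat \<Rightarrow> real) \<Rightarrow> nat" where
  "first_balk p = (LEAST n. p n = 0)"

text \<open>
  The condition \<open>n \<le> n\<^sub>0 - 2\<close> is stated over the integers, because \<open>n\<^sub>0 = 1\<close> when \<open>x < 1\<close>.
\<close>

definition mixed_threshold :: "real \<Rightarrow> nat \<Rightarrow> real" where
  "mixed_threshold x n =
     (let n0 = \<lfloor>x\<rfloor> + 1 in
      if int n \<le> n0 - 2 then 1
      else if int n = \<lfloor>x\<rfloor> then x - of_int \<lfloor>x\<rfloor>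
      else 0)"

text \<open>
  The Markov chain seen by a tagged customer. The state \<open>Some (i, k)\<close> means that \<open>i\<close> customers are in
  front of her and \<open>k\<close> are in the system, herself included; \<open>None\<close> means that she has departed.
  At every step two fresh independent unit exponentials \<open>(a, s)\<close> are drawn; dividing them by the
  rates \<open>lam * p k\<close> and \<open>mu k\<close> gives the times until the next joining arrival and the next service
  completion, and the earlier of the two is the next transition. By the competing-exponentials
  property this is the continuous-time Markov chain with these transition rates.
\<close>

definition clock :: "real \<Rightarrow> real \<Rightarrow> ennreal" where
  "clock r e = (if r = 0 then \<infinity> else ennreal (e / r))"

fun next_state ::
  "real \<Rightarrow> (nat \<Rightarrow> real) \<Rightarrow> (nat \<Rightarrow> real) \<Rightarrow> real \<times> real \<Rightarrow> (nat \<times> nat) option \<Rightarrow> (nat \<times> nat) option"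
where
  "next_state lam mu p (a, s) None = None"
| "next_state lam mu p (a, s) (Some (i, k)) =
     (if clock (lam * p k) a < clock (mu k) s then Some (i, k + 1)
      else if i \<ge> 1 then Some (i - 1, k - 1)
      else None)"

text \<open>Time spent in a state; the departed state contributes nothing.\<close>

fun holding_time ::
  "real \<Rightarrow> (nat \<Rightarrow> real) \<Rightarrow> (nat \<Rightarrow> real) \<Rightarrow> real \<times> real \<Rightarrow> (nat \<times> nat) option \<Rightarrow> ennreal"
where
  "holding_time lam mu p (a, s) None = 0"
| "holding_time lam mu p (a, s) (Some (i, k)) = min (clock (lam * p k) a) (clock (mu k) s)"

primrec jump_chain ::
  "real \<Rightarrow> (nat \<Rightarrow> real) \<Rightarrow> (nat \<Rightarrow> real) \<Rightarrow> (nat \<times> nat) option \<Rightarrow> (real \<times> real) stream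
    \<Rightarrow> nat \<Rightarrow> (nat \<times> nat) option"
where
  "jump_chain lam mu p z \<omega> 0 = z"
| "jump_chain lam mu p z \<omega> (Suc j) = next_state lam mu p (\<omega> !! j) (jump_chain lam mu p z \<omega> j)"

definition departure_time ::
  "real \<Rightarrow> (nat \<Rightarrow> real) \<Rightarrow> (nat \<Rightarrow> real) \<Rightarrow> (nat \<times> nat) option \<Rightarrow> (real \<times> real) stream \<Rightarrow> ennreal"
where
  "departure_time lam mu p z \<omega> = (\<Sum>j. holding_time lam mu p (\<omega> !! j) (jump_chain lam mu p z \<omega> j))"

definition unit_exponential :: "real measure" where
  "unit_exponential = density lborel (\<lambda>t. ennreal (exponential_density 1 t))"

definition clock_space :: "(real \<times> real) stream measure" where
  "clock_space = stream_space (unit_exponential \<Otimes>\<^sub>M unit_exponential)"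

text \<open>
  The delay function, meant for \<open>n < m\<close>. It is extended-real valued, so that no integrability
  needs to be presupposed.
\<close>

definition W :: "real \<Rightarrow> (nat \<Rightarrow> real) \<Rightarrow> (nat \<Rightarrow> real) \<Rightarrow> nat \<Rightarrow> nat \<Rightarrow> ereal" where
  "W lam mu p n m =
     enn2ereal (\<integral>\<^sup>+ \<omega>. departure_time lam mu p (Some (n, m)) \<omega> \<partial>clock_space)"

text \<open>\<open>Rt\<close> is the reward divided by the waiting cost per unit of time.\<close>

definition recurrent_class_equilibrium ::
  "real \<Rightarrow> (nat \<Rightarrow> real) \<Rightarrow> real \<Rightarrow> (nat \<Rightarrow> real) \<Rightarrow> bool"
where
  "recurrent_class_equilibrium lam mu Rt p \<longleftrightarrow>
     strategy p \<and> (\<exists>n. p n = 0) \<and>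
     (\<forall>n \<le> first_balk p.
        (p n = 0 \<longrightarrow> ereal Rt - W lam mu p n (n + 1) \<le> 0) \<and>
        (p n = 1 \<longrightarrow> ereal Rt - W lam mu p n (n + 1) \<ge> 0) \<and>
        (0 < p n \<and> p n < 1 \<longrightarrow> ereal Rt - W lam mu p n (n + 1) = 0))"

definition Omega_TH :: "real \<Rightarrow> (nat \<Rightarrow> real) \<Rightarrow> real \<Rightarrow> (nat \<Rightarrow> real) set" where
  "Omega_TH lam mu Rt =
     {p. (\<exists>x. x > 0 \<and> x \<notin> \<int> \<and> p = mixed_threshold x) \<and> recurrent_class_equilibrium lam mu Rt p}"

end

(*
  A tagged customer who finds n customers (chain B) is coupled with one who finds n + 1 (chain A).
  As joining probabilities are non-increasing and service rates non-decreasing in the queue length,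
  arrivals in A can be matched by arrivals in B, and services in B by services in A. An unmatched
  service in A makes the two chains coincide, and an unmatched arrival in B leaves equal totals
  with fewer customers ahead in B. Hence W(n) is non-decreasing in n, so indifference at the
  threshold implies the other equilibrium conditions. The coupling is carried out analytically, by
  comparing the first-step equations term by term; since nobody joins above the threshold, these
  equations form a recursion on the position and on the distance of the queue length to the
  threshold.
*)

theory Submission
  imports Defs
begin

section \<open>Competing exponential clocks\<close>

lemma prob_space_unit_exponential: "prob_space unit_exponential"
  unfolding unit_exponential_def by (rule prob_space_exponential_density) simp

lemma sets_unit_exponential [measurable_cong, simp]: "sets unit_exponential = sets borel"
  by (simp add: unit_exponential_def)

lemma space_unit_exponential [simp]: "space unit_exponential = UNIV"
  by (simp add: unit_exponential_def)

lemma emeasure_unit_exponential_greaterThan: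
  assumes "0 \<le> t"
  shows "emeasure unit_exponential {t<..} = ennreal (exp (- t))"
proof -
  interpret prob_space unit_exponential by (rule prob_space_unit_exponential)
  have "distributed unit_exponential lborel (\<lambda>x. x) (exponential_density 1)"
    unfolding distributed_def by (auto simp: unit_exponential_def distr_id2)
  from exponential_distributedD_gt[OF this assms] show ?thesis
    by (simp add: emeasure_eq_measure greaterThan_def)
qed

lemma nn_integral_unit_exponential:
  assumes "f \<in> borel_measurable borel"
  shows "(\<integral>\<^sup>+ e. f e \<partial>unit_exponential)
    = (\<integral>\<^sup>+ e. ennreal (exponential_density 1 e) * f e \<partial>lborel)"
  unfolding unit_exponential_def using assms by (intro nn_integral_density) auto

lemma pair_prob_space_unit_exponential: "pair_prob_space unit_exponential unit_exponential"
  by (intro pair_prob_space.intro pair_sigma_finite.intro prob_space_imp_sigma_finite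
      prob_space_unit_exponential)

lemma borel_measurable_clock [measurable]: "clock r \<in> borel_measurable borel"
  unfolding clock_def by (cases "r = 0") simp_all

lemma min_clock:
  assumes "0 < b"
  shows "min (clock a e) (clock b f) = ennreal (if a = 0 then f / b else min (e / a) (f / b))"
proof -
  have "min (ennreal u) (ennreal v) = ennreal (min u v)" for u v
    by (cases "u \<le> v") (simp_all add: min_absorb1 min_absorb2 ennreal_leI)
  with assms show ?thesis by (simp add: clock_def)
qed

text \<open>The minimum of independent exponential times with rates \<open>a\<close> and
  \<open>b\<close> is exponential with rate \<open>a + b\<close>, whose mean is the right-hand side.
  The case \<open>a = 0\<close>, nobody joining, is an infinite first clock.\<close>

lemma nn_integral_min_clock:
  assumes "0 \<le> a" "0 < b"
  shows "(\<integral>\<^sup>+ x. min (clock a (fst x)) (clock b (snd x)) \<partial>(unit_exponential \<Otimes>\<^sub>M unit_exponential))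
    = ennreal (1 / (a + b))"
proof -
  let ?P = "unit_exponential \<Otimes>\<^sub>M unit_exponential"
  interpret U: prob_space unit_exponential by (rule prob_space_unit_exponential)
  interpret P: pair_prob_space unit_exponential unit_exponential
    by (rule pair_prob_space_unit_exponential)
  define T where "T x = (if a = 0 then snd x / b else min (fst x / a) (snd x / b))"
    for x :: "real \<times> real"
  have T [measurable]: "T \<in> borel_measurable ?P"
    unfolding T_def by (cases "a = 0") simp_all
  have "distributed ?P lborel T (exponential_density (a + b))"
  proof (rule exponential_distributedI)
    fix t :: real assume t: "0 \<le> t"
    \<comment> \<open>Draws for which the first clock exceeds \<open>t\<close>; with
      \<open>a = 0\<close> that clock is infinite, so every draw qualifies. The event
      \<open>T x > t\<close> is then a rectangle, and independence multiplies the two tails.\<close>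
    define A where "A = (if a = 0 then UNIV else {t * a<..})"
    have A: "emeasure unit_exponential A = ennreal (exp (- (t * a)))"
      using t assms U.emeasure_space_1
      by (auto simp: A_def emeasure_unit_exponential_greaterThan)
    have "{x \<in> space ?P. T x \<le> t} = space ?P - A \<times> {t * b<..}"
      using assms by (auto simp: T_def A_def space_pair_measure min_le_iff_disj pos_divide_le_eq)
    also have "emeasure ?P \<dots> = emeasure ?P (space ?P) - emeasure ?P (A \<times> {t * b<..})"
      by (rule emeasure_compl) (auto simp: A_def P.emeasure_pair_measure_Times)
    also have "\<dots> = 1 - ennreal (exp (- (t * a)) * exp (- (t * b)))"
    proof -
      have "emeasure ?P (A \<times> {t * b<..})
          = emeasure unit_exponential A * emeasure unit_exponential {t * b<..}"
        by (rule U.emeasure_pair_measure_Times) (simp_all add: A_def)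
      then show ?thesis
        using t assms P.emeasure_space_1
        by (simp add: A emeasure_unit_exponential_greaterThan ennreal_mult)
    qed
    also have "exp (- (t * a)) * exp (- (t * b)) = exp (- t * (a + b))"
      by (simp add: exp_add[symmetric] algebra_simps)
    finally show "emeasure ?P {x \<in> space ?P. T x \<le> t} = 1 - ennreal (exp (- t * (a + b)))" .
  qed (use assms in auto)
  from distributed_nn_integral[OF this, of ennreal]
  have "(\<integral>\<^sup>+ x. ennreal (T x) \<partial>?P)
      = (\<integral>\<^sup>+ x. ennreal (exponential_density (a + b) x) * ennreal x \<partial>lborel)"
    by simp
  \<comment> \<open>The power \<open>x ^ 1\<close> exhibits the integral as a first moment, the
    shape of the Erlang moment formula.\<close>
  also have "\<dots> = (\<integral>\<^sup>+ x. ennreal (exponential_density (a + b) x * x ^ 1) \<partial>lborel)"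
    using assms by (intro nn_integral_cong) (simp add: ennreal_mult' exponential_density_nonneg)
  also have "\<dots> = ennreal (1 / (a + b))"
    using assms by (subst nn_integral_erlang_ith_moment) auto
  finally show ?thesis
    using assms by (simp add: min_clock T_def)
qed

text \<open>Given the first draw \<open>e\<close>, the second clock rings later with probability
  \<open>exp (- (e * b / a))\<close>; this is then averaged over \<open>e\<close>. For
  \<open>a = 0\<close> the event is empty.\<close>

lemma emeasure_clock_less:
  assumes "0 \<le> a" "0 < b"
  shows "emeasure (unit_exponential \<Otimes>\<^sub>M unit_exponential) {x. clock a (fst x) < clock b (snd x)}
    = ennreal (a / (a + b))"
proof (cases "a = 0")
  case True
  then show ?thesis by (simp add: clock_def)
next
  case False
  with assms have a: "0 < a" by simp
  let ?P = "unit_exponential \<Otimes>\<^sub>M unit_exponential"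
  interpret U: prob_space unit_exponential by (rule prob_space_unit_exponential)
  let ?A = "{x. clock a (fst x) < clock b (snd x)}"
  have "{x \<in> space ?P. clock a (fst x) < clock b (snd x)} \<in> sets ?P"
    by measurable
  then have A: "?A \<in> sets ?P" by (simp add: space_pair_measure)
  have "emeasure ?P ?A = (\<integral>\<^sup>+ e. emeasure unit_exponential (Pair e -` ?A) \<partial>unit_exponential)"
    by (rule U.emeasure_pair_measure_alt[OF A])
  also have "\<dots> = (\<integral>\<^sup>+ e. ennreal (exponential_density 1 e)
      * emeasure unit_exponential (Pair e -` ?A) \<partial>lborel)"
    using U.measurable_emeasure_Pair[OF A] by (intro nn_integral_unit_exponential) simp
  \<comment> \<open>Density times tail decays at rate \<open>1 + b / a = (a + b) / a\<close>;
    normalising it to a probability density leaves the factor \<open>a / (a + b)\<close>.\<close>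
  also have "\<dots> = (\<integral>\<^sup>+ e. ennreal (a / (a + b)) * ennreal (exponential_density (1 + b / a) e) \<partial>lborel)"
  proof (intro nn_integral_cong)
    fix e :: real
    show "ennreal (exponential_density 1 e) * emeasure unit_exponential (Pair e -` ?A)
      = ennreal (a / (a + b)) * ennreal (exponential_density (1 + b / a) e)"
    proof (cases "e < 0")
      case True
      then show ?thesis by (simp add: exponential_density_def)
    next
      case e: False
      then have "Pair e -` ?A = {e * b / a<..}"
        using a assms by (auto simp: clock_def ennreal_less_iff field_simps)
      then have "emeasure unit_exponential (Pair e -` ?A) = ennreal (exp (- (e * b / a)))"
        using e a assms by (simp add: emeasure_unit_exponential_greaterThan)
      moreover have "exponential_density 1 e * exp (- (e * b / a))
          = a / (a + b) * exponential_density (1 + b / a) e"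
      proof -
        have "exp (- e) * exp (- (e * b / a)) = exp (- ((1 + b / a) * e))"
          by (simp add: exp_add[symmetric] algebra_simps)
        moreover have "a / (a + b) * (1 + b / a) = 1"
        proof -
          have "1 + b / a = (a + b) / a"
            using a by (simp add: add_divide_distrib)
          then show ?thesis using a assms by simp
        qed
        moreover have "a / (a + b) * exponential_density (1 + b / a) e
            = a / (a + b) * (1 + b / a) * exp (- ((1 + b / a) * e))"
          using e by (simp only: exponential_density_def if_False) (simp add: mult.commute)
        ultimately show ?thesis
          using e by (simp only: mult_1) (simp add: exponential_density_def)
      qed
      ultimately show ?thesis
        using a assms by (simp add: ennreal_mult'[symmetric] exponential_density_nonneg)
    qed
  qed
  also have "\<dots> = ennreal (a / (a + b))"
  proof -
    have "(\<integral>\<^sup>+ e. ennreal (exponential_density (1 + b / a) e) \<partial>lborel) = 1"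
      using nn_integral_erlang_ith_moment[of "1 + b / a" 0 0] a assms by (simp add: add_pos_pos)
    then show ?thesis by (simp add: nn_integral_cmult)
  qed
  finally show ?thesis .
qed

section \<open>First-step analysis of the tagged customer's chain\<close>

lemma measurable_next_state [measurable]:
  "(\<lambda>x. next_state lam mu p x z)
    \<in> measurable (unit_exponential \<Otimes>\<^sub>M unit_exponential) (count_space UNIV)"
proof (cases z)
  case None
  have "next_state lam mu p x None = None" for x by (cases x) simp
  with None show ?thesis by simp
next
  case (Some ik)
  obtain i k where ik: "ik = (i, k)" by force
  have "next_state lam mu p x (Some (i, k)) =
     (if clock (lam * p k) (fst x) < clock (mu k) (snd x) then Some (i, k + 1)
      else if i \<ge> 1 then Some (i - 1, k - 1) else None)" for x by (cases x) simp
  then show ?thesis unfolding Some ik by simp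
qed

lemma measurable_holding_time [measurable]:
  "(\<lambda>x. holding_time lam mu p x z) \<in> borel_measurable (unit_exponential \<Otimes>\<^sub>M unit_exponential)"
proof (cases z)
  case None
  have "holding_time lam mu p x None = 0" for x by (cases x) simp
  with None show ?thesis by simp
next
  case (Some ik)
  obtain i k where ik: "ik = (i, k)" by force
  have "holding_time lam mu p x (Some (i, k))
     = min (clock (lam * p k) (fst x)) (clock (mu k) (snd x))" for x by (cases x) simp
  then show ?thesis unfolding Some ik by simp
qed

lemma measurable_jump_chain [measurable]:
  "(\<lambda>\<omega>. jump_chain lam mu p z \<omega> j) \<in> measurable clock_space (count_space UNIV)"
proof (induction j)
  case (Suc j)
  have [measurable]: "(\<lambda>\<omega>. \<omega> !! j) \<in> measurable clock_space (unit_exponential \<Otimes>\<^sub>M unit_exponential)"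
    unfolding clock_space_def by simp
  show ?case
    unfolding jump_chain.simps
    \<comment> \<open>The state space is countable, so measurability for each fixed current state
      suffices.\<close>
    by (rule measurable_compose_countable[OF _ Suc]) simp
qed simp

lemma measurable_departure_time [measurable]:
  "departure_time lam mu p z \<in> borel_measurable clock_space"
proof -
  have "(\<lambda>\<omega>. holding_time lam mu p (\<omega> !! j) (jump_chain lam mu p z \<omega> j)) \<in> borel_measurable clock_space"
    for j
  proof (rule measurable_compose_countable[OF _ measurable_jump_chain])
    have [measurable]: "(\<lambda>\<omega>. \<omega> !! j) \<in> measurable clock_space (unit_exponential \<Otimes>\<^sub>M unit_exponential)"
      unfolding clock_space_def by simp
    show "(\<lambda>\<omega>. holding_time lam mu p (\<omega> !! j) y) \<in> borel_measurable clock_space" for y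
      by simp
  qed
  then show ?thesis unfolding departure_time_def[abs_def] by measurable
qed

text \<open>The recursion of \<open>jump_chain\<close> splits off the last draw, whereas first-step
  analysis needs the first one split off.\<close>

lemma jump_chain_Stream:
  "jump_chain lam mu p z (x ## \<omega>) (Suc j) = jump_chain lam mu p (next_state lam mu p x z) \<omega> j"
  by (induction j) simp_all

lemma departure_time_Stream:
  "departure_time lam mu p z (x ## \<omega>)
    = holding_time lam mu p x z + departure_time lam mu p (next_state lam mu p x z) \<omega>"
  unfolding departure_time_def
  by (subst suminf_offset[where i = 1]) (simp_all add: jump_chain_Stream del: jump_chain.simps(2))

text \<open>Kept in \<open>ennreal\<close> and defined for the departed state too, so that the
  first-step equations close up before finiteness is known.\<close>

definition expected_departure ::
  "real \<Rightarrow> (nat \<Rightarrow> real) \<Rightarrow> (nat \<Rightarrow> real) \<Rightarrow> (nat \<times> nat) option \<Rightarrow> ennreal"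
where
  "expected_departure lam mu p z = (\<integral>\<^sup>+ \<omega>. departure_time lam mu p z \<omega> \<partial>clock_space)"

text \<open>The head of the stream is independent of its tail, and the tail is again distributed as
  \<open>clock_space\<close>: this is the Markov property at the first transition.\<close>

lemma expected_departure_first_step:
  "expected_departure lam mu p z =
    (\<integral>\<^sup>+ x. holding_time lam mu p x z + expected_departure lam mu p (next_state lam mu p x z)
      \<partial>(unit_exponential \<Otimes>\<^sub>M unit_exponential))"
proof -
  let ?P = "unit_exponential \<Otimes>\<^sub>M unit_exponential"
  interpret pair_prob_space unit_exponential unit_exponential
    by (rule pair_prob_space_unit_exponential)
  interpret P: prob_space ?P by unfold_locales
  interpret S: prob_space clock_space
    unfolding clock_space_def by (rule P.prob_space_stream_space)
  have "expected_departure lam mu p z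
      = (\<integral>\<^sup>+ x. \<integral>\<^sup>+ \<omega>. departure_time lam mu p z (x ## \<omega>) \<partial>clock_space \<partial>?P)"
    using P.nn_integral_stream_space[of "departure_time lam mu p z"] measurable_departure_time
    unfolding expected_departure_def clock_space_def by simp
  then show ?thesis
    unfolding departure_time_Stream
    by (simp add: nn_integral_add expected_departure_def S.emeasure_space_1)
qed

lemma expected_departure_None: "expected_departure lam mu p None = 0"
proof -
  have "jump_chain lam mu p None \<omega> j = None" for \<omega> j
  proof (induction j)
    case (Suc j)
    then show ?case by (cases "\<omega> !! j") simp
  qed simp
  moreover have "holding_time lam mu p x None = 0" for x by (cases x) simp
  ultimately show ?thesis by (simp add: expected_departure_def departure_time_def)
qed

lemma expected_departure_Some:
  assumes "0 \<le> lam * p k" "0 < mu k"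
  shows "expected_departure lam mu p (Some (i, k)) =
    ennreal (1 / (lam * p k + mu k))
    + ennreal (lam * p k / (lam * p k + mu k)) * expected_departure lam mu p (Some (i, k + 1))
    + ennreal (mu k / (lam * p k + mu k))
      * expected_departure lam mu p (if i \<ge> 1 then Some (i - 1, k - 1) else None)"
proof -
  let ?P = "unit_exponential \<Otimes>\<^sub>M unit_exponential"
  interpret pair_prob_space unit_exponential unit_exponential
    by (rule pair_prob_space_unit_exponential)
  interpret P: prob_space ?P by unfold_locales
  let ?a = "lam * p k" and ?b = "mu k" and ?V = "expected_departure lam mu p"
  let ?up = "Some (i, k + 1)" and ?down = "if i \<ge> 1 then Some (i - 1, k - 1) else None"
  define A where "A = {x. clock ?a (fst x) < clock ?b (snd x)}"
  have "{x \<in> space ?P. clock ?a (fst x) < clock ?b (snd x)} \<in> sets ?P"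
    by measurable
  then have A [measurable]: "A \<in> sets ?P" by (simp add: A_def space_pair_measure)
  have space: "space ?P = UNIV" by (simp add: space_pair_measure)
  have A': "- A \<in> sets ?P" using sets.compl_sets[OF A] by (simp add: space Compl_eq_Diff_UNIV)
  have emA: "emeasure ?P A = ennreal (?a / (?a + ?b))"
    unfolding A_def by (rule emeasure_clock_less) fact+
  have "emeasure ?P (- A) = 1 - ennreal (?a / (?a + ?b))"
    using emeasure_compl[OF A] P.emeasure_space_1 emA by (simp add: space Compl_eq_Diff_UNIV)
  also have "\<dots> = ennreal (1 - ?a / (?a + ?b))"
    using assms by (simp add: ennreal_minus ennreal_1[symmetric] del: ennreal_1)
  also have "1 - ?a / (?a + ?b) = ?b / (?a + ?b)"
    using assms by (simp add: field_simps)
  finally have emA': "emeasure ?P (- A) = ennreal (?b / (?a + ?b))" .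
  \<comment> \<open>The state after the transition depends only on which clock rings first, so the
    continuation is constant on \<open>A\<close> and on its complement.\<close>
  have "holding_time lam mu p x (Some (i, k)) + ?V (next_state lam mu p x (Some (i, k)))
      = min (clock ?a (fst x)) (clock ?b (snd x))
        + (?V ?up * indicator A x + ?V ?down * indicator (- A) x)" for x
    by (cases x) (auto simp: A_def)
  then have "?V (Some (i, k)) = (\<integral>\<^sup>+ x. min (clock ?a (fst x)) (clock ?b (snd x))
        + (?V ?up * indicator A x + ?V ?down * indicator (- A) x) \<partial>?P)"
    by (subst expected_departure_first_step) simp
  also have "\<dots> = (\<integral>\<^sup>+ x. min (clock ?a (fst x)) (clock ?b (snd x)) \<partial>?P)
      + (?V ?up * emeasure ?P A + ?V ?down * emeasure ?P (- A))"
    using A A' by (simp add: nn_integral_add nn_integral_cmult)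
  finally show ?thesis
    using assms by (simp add: nn_integral_min_clock emA emA' mult.commute add.assoc)
qed

section \<open>Finite delays and their monotonicity\<close>

text \<open>The cutoff \<open>K\<close> makes the recursion on the queue length terminate;
  \<open>p_antimono\<close> makes the rate of arrivals joining only the shorter queue
  nonnegative.\<close>

locale threshold_queue =
  fixes lam :: real and mu p :: "nat \<Rightarrow> real" and K :: nat
  assumes lam_pos: "0 < lam"
    and mu_pos: "1 \<le> k \<Longrightarrow> 0 < mu k"
    and p_nonneg: "0 \<le> p k"
    and p_antimono: "p (k + 1) \<le> p k"
    and p_eq_0: "K \<le> k \<Longrightarrow> p k = 0"
begin

definition delay :: "nat \<Rightarrow> nat \<Rightarrow> real" where
  "delay i k = enn2real (expected_departure lam mu p (Some (i, k)))"

lemma lam_p_nonneg: "0 \<le> lam * p k"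
  using lam_pos p_nonneg by simp

text \<open>A service lowers \<open>i\<close> and an arrival lowers \<open>K - k\<close>, so a
  nested induction on the two covers both successors of a state.\<close>

lemma expected_departure_finite:
  "i < k \<Longrightarrow> expected_departure lam mu p (Some (i, k)) < top"
proof (induction i arbitrary: k)
  case 0
  then show ?case
  proof (induction "K - k" arbitrary: k rule: less_induct)
    case less
    \<comment> \<open>From \<open>K\<close> on, the distance \<open>K - k\<close> no longer drops,
      but the arrival term has coefficient 0, and 0 times anything is 0 in
      \<open>ennreal\<close>.\<close>
    have "p k = 0 \<or> expected_departure lam mu p (Some (0, k + 1)) < top"
      using less.hyps[of "k + 1"] less.prems p_eq_0[of k] by linarith
    then show ?case
      using less.prems lam_p_nonneg[of k] mu_pos[of k]
      by (subst expected_departure_Some)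
        (auto simp: expected_departure_None ennreal_mult_less_top)
  qed
next
  case (Suc i)
  note outer = Suc.IH
  from Suc.prems show ?case
  proof (induction "K - k" arbitrary: k rule: less_induct)
    case less
    have "p k = 0 \<or> expected_departure lam mu p (Some (Suc i, k + 1)) < top"
      using less.hyps[of "k + 1"] less.prems p_eq_0[of k] by linarith
    moreover have "expected_departure lam mu p (Some (i, k - 1)) < top"
      using outer[of "k - 1"] less.prems by simp
    ultimately show ?case
      using less.prems lam_p_nonneg[of k] mu_pos[of k]
      by (subst expected_departure_Some) (auto simp: ennreal_mult_less_top)
  qed
qed

lemma expected_departure_eq_delay:
  "i < k \<Longrightarrow> expected_departure lam mu p (Some (i, k)) = ennreal (delay i k)"
  using expected_departure_finite[of i k] by (simp add: delay_def)

lemma delay_nonneg: "0 \<le> delay i k"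
  by (simp add: delay_def)

lemma W_eq_delay: "i < k \<Longrightarrow> W lam mu p i k = ereal (delay i k)"
  by (simp add: W_def expected_departure_def[symmetric] expected_departure_eq_delay delay_nonneg)

text \<open>The first-step equation in real numbers, multiplied by the total rate so that two such
  equations can be subtracted without fractions.\<close>

lemma delay_step:
  assumes "i < k"
  shows "(lam * p k + mu k) * delay i k =
    1 + lam * p k * delay i (k + 1) + mu k * (if i = 0 then 0 else delay (i - 1) (k - 1))"
proof -
  let ?s = "lam * p k + mu k" and ?d = "if i = 0 then 0 else delay (i - 1) (k - 1)"
  have pos: "0 < mu k" "0 < ?s"
    using assms mu_pos[of k] lam_p_nonneg[of k] by simp_all
  have "expected_departure lam mu p (if i \<ge> 1 then Some (i - 1, k - 1) else None) = ennreal ?d"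
    using assms expected_departure_eq_delay[of "i - 1" "k - 1"] by (auto simp: expected_departure_None)
  then have "ennreal (delay i k)
      = ennreal (1 / ?s + lam * p k / ?s * delay i (k + 1) + mu k / ?s * ?d)"
    using expected_departure_Some[of lam p k mu i] assms pos lam_p_nonneg[of k]
      expected_departure_eq_delay[of i k] expected_departure_eq_delay[of i "k + 1"]
    by (simp add: delay_nonneg ennreal_mult'[symmetric] ennreal_plus[symmetric] del: ennreal_plus)
  then have "delay i k = 1 / ?s + lam * p k / ?s * delay i (k + 1) + mu k / ?s * ?d"
    using pos lam_p_nonneg[of k] by (subst (asm) ennreal_inj) (simp_all add: delay_nonneg)
  also have "\<dots> = (1 + lam * p k * delay i (k + 1) + mu k * ?d) / ?s"
    by (simp only: add_divide_distrib times_divide_eq_left)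
  finally show ?thesis using pos by simp
qed

text \<open>With equal totals both chains have the same rates, so all transitions can be shared, and
  the customer further ahead leaves no later.\<close>

lemma delay_le_Suc_front:
  "i + 1 < k \<Longrightarrow> delay i k \<le> delay (i + 1) k"
proof (induction i arbitrary: k rule: less_induct)
  case (less i)
  note outer = less.IH
  from less.prems show ?case
  proof (induction "K - k" arbitrary: k rule: less_induct)
    case (less k)
    let ?s = "lam * p k + mu k" and ?d = "if i = 0 then 0 else delay (i - 1) (k - 1)"
    have pos: "0 < mu k" "0 < ?s"
      using less.prems mu_pos[of k] lam_p_nonneg[of k] by simp_all
    have "lam * p k * delay i (k + 1) \<le> lam * p k * delay (i + 1) (k + 1)"
    proof (cases "K \<le> k")
      case False
      then show ?thesis
        using less.hyps[of "k + 1"] less.prems lam_p_nonneg[of k] by (intro mult_left_mono) auto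
    qed (simp add: p_eq_0)
    \<comment> \<open>For \<open>i = 0\<close> the service ends the shorter delay, and nonnegativity
      of the other one is enough.\<close>
    moreover have "mu k * ?d \<le> mu k * delay i (k - 1)"
      using outer[of "i - 1" "k - 1"] less.prems pos delay_nonneg
      by (intro mult_left_mono) auto
    ultimately have "?s * delay i k \<le> ?s * delay (i + 1) k"
      using less.prems by (simp add: delay_step)
    then show ?case using pos by simp
  qed
qed

text \<open>
  The terms correspond to the transitions of the coupled chains from \<open>(i + 1, k + 1)\<close> and
  \<open>(i, k)\<close>: joint arrivals, arrivals to the second chain only, and joint services. Services in the
  first chain only contribute nothing, as both chains agree afterwards.
\<close>

lemma delay_diff_step:
  assumes "i < k"
  shows "(lam * p k + mu (k + 1)) * (delay (i + 1) (k + 1) - delay i k) =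
    lam * p (k + 1) * (delay (i + 1) (k + 2) - delay i (k + 1))
    + lam * (p k - p (k + 1)) * (delay (i + 1) (k + 1) - delay i (k + 1))
    + mu k * (delay i k - (if i = 0 then 0 else delay (i - 1) (k - 1)))"
  using delay_step[OF assms] delay_step[of "i + 1" "k + 1"] assms
  by (simp add: algebra_simps)

text \<open>All three terms of \<open>delay_diff_step\<close> are nonnegative: joint arrivals by the
  inner induction, unmatched arrivals by \<open>delay_le_Suc_front\<close>, joint services by the
  outer induction.\<close>

lemma delay_le_Suc_Suc:
  "i < k \<Longrightarrow> delay i k \<le> delay (i + 1) (k + 1)"
proof (induction i arbitrary: k rule: less_induct)
  case (less i)
  note outer = less.IH
  from less.prems show ?case
  proof (induction "K - k" arbitrary: k rule: less_induct)
    case (less k)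
    have pos: "0 < lam * p k + mu (k + 1)" "0 < mu k"
      using less.prems mu_pos[of k] mu_pos[of "k + 1"] lam_p_nonneg[of k] by simp_all
    have "0 \<le> lam * p (k + 1) * (delay (i + 1) (k + 2) - delay i (k + 1))"
    proof (cases "K \<le> k")
      case False
      then show ?thesis
        using less.hyps[of "k + 1"] less.prems lam_pos p_nonneg[of "k + 1"]
        by (intro mult_nonneg_nonneg) auto
    qed (simp add: p_eq_0)
    moreover have "0 \<le> lam * (p k - p (k + 1)) * (delay (i + 1) (k + 1) - delay i (k + 1))"
      using delay_le_Suc_front[of i "k + 1"] less.prems lam_pos p_antimono[of k] by simp
    moreover have "0 \<le> mu k * (delay i k - (if i = 0 then 0 else delay (i - 1) (k - 1)))"
      using outer[of "i - 1" "k - 1"] less.prems pos delay_nonneg by auto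
    ultimately have "0 \<le> (lam * p k + mu (k + 1)) * (delay (i + 1) (k + 1) - delay i k)"
      using delay_diff_step[OF less.prems] by simp
    then show ?case using pos by (simp add: zero_le_mult_iff)
  qed
qed

lemma delay_on_arrival_mono: "m \<le> n \<Longrightarrow> delay m (m + 1) \<le> delay n (n + 1)"
proof (induction n rule: dec_induct)
  case (step n)
  then show ?case
    using delay_le_Suc_Suc[of n "n + 1"] by simp
qed simp

end

section \<open>Indifference at the threshold and equilibrium\<close>

theorem theorem2:
  fixes lam M R C x :: real and mu :: "nat \<Rightarrow> real"
  assumes "lam > 0"
    and "\<And>n. n \<ge> 1 \<Longrightarrow> 0 < mu n"
    and "\<And>n. n \<ge> 1 \<Longrightarrow> mu n \<le> mu (n + 1)"
    and "mu \<longlonglongrightarrow> M"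
    and "R \<ge> 0"
    and "C > 0"
    and "x > 0"
    and "x \<notin> \<int>"
  shows "mixed_threshold x \<in> Omega_TH lam mu (R / C) \<longleftrightarrow>
    W lam mu (mixed_threshold x) (nat \<lfloor>x\<rfloor>) (nat \<lfloor>x\<rfloor> + 1) = ereal (R / C)"
proof -
  define p where "p = mixed_threshold x"
  define N where "N = nat \<lfloor>x\<rfloor>"
  define q where "q = x - of_int \<lfloor>x\<rfloor>"
  have N: "\<lfloor>x\<rfloor> = int N"
    using \<open>x > 0\<close> by (simp add: N_def)
  have q: "0 < q" "q < 1"
    using \<open>x \<notin> \<int>\<close> by (simp_all add: q_def frac_def[symmetric] frac_gt_0_iff frac_lt_1)
  have p: "p n = (if n < N then 1 else if n = N then q else 0)" for n
    by (auto simp: p_def mixed_threshold_def N q_def Let_def)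
  \<comment> \<open>Customers still join at \<open>N\<close> with probability \<open>q > 0\<close>,
    so the cutoff is \<open>N + 1\<close>; \<open>q < 1\<close> gives the decrease from
    \<open>N - 1\<close> to \<open>N\<close>.\<close>
  interpret threshold_queue lam mu p "N + 1"
    by unfold_locales (use assms q in \<open>auto simp: p\<close>)
  have first_balk: "first_balk p = N + 1"
    unfolding first_balk_def by (rule Least_equality) (use q in \<open>auto simp: p split: if_splits\<close>)
  have W: "W lam mu p n (n + 1) = ereal (delay n (n + 1))" for n
    by (rule W_eq_delay) simp
  have "strategy p"
    using q by (simp add: strategy_def p)
  moreover have "\<exists>n. p n = 0"
    by (rule exI[of _ "N + 1"]) (simp add: p)
  moreover have "\<exists>y. y > 0 \<and> y \<notin> \<int> \<and> p = mixed_threshold y"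
    using assms p_def by blast
  ultimately have "p \<in> Omega_TH lam mu (R / C) \<longleftrightarrow>
      (\<forall>n \<le> first_balk p.
        (p n = 0 \<longrightarrow> ereal (R / C) - W lam mu p n (n + 1) \<le> 0) \<and>
        (p n = 1 \<longrightarrow> ereal (R / C) - W lam mu p n (n + 1) \<ge> 0) \<and>
        (0 < p n \<and> p n < 1 \<longrightarrow> ereal (R / C) - W lam mu p n (n + 1) = 0))"
    unfolding Omega_TH_def recurrent_class_equilibrium_def by simp
  also have "\<dots> \<longleftrightarrow> (\<forall>n \<le> N + 1.
      (p n = 0 \<longrightarrow> R / C \<le> delay n (n + 1)) \<and> (p n = 1 \<longrightarrow> delay n (n + 1) \<le> R / C) \<and>
      (0 < p n \<and> p n < 1 \<longrightarrow> delay n (n + 1) = R / C))"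
    unfolding first_balk W by (simp add: zero_ereal_def eq_commute[of "R / C"])
  also have "\<dots> \<longleftrightarrow> delay N (N + 1) = R / C"
  proof
    assume eq: "delay N (N + 1) = R / C"
    show "\<forall>n \<le> N + 1.
      (p n = 0 \<longrightarrow> R / C \<le> delay n (n + 1)) \<and> (p n = 1 \<longrightarrow> delay n (n + 1) \<le> R / C) \<and>
      (0 < p n \<and> p n < 1 \<longrightarrow> delay n (n + 1) = R / C)"
    proof (intro allI impI)
      fix n
      show "(p n = 0 \<longrightarrow> R / C \<le> delay n (n + 1)) \<and> (p n = 1 \<longrightarrow> delay n (n + 1) \<le> R / C) \<and>
        (0 < p n \<and> p n < 1 \<longrightarrow> delay n (n + 1) = R / C)"
        \<comment> \<open>As \<open>0 < q < 1\<close>, the cases \<open>p n = 1\<close>,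
          \<open>p n = 0\<close> and mixing mean \<open>n < N\<close>, \<open>n > N\<close> and
          \<open>n = N\<close>; monotonicity compares each delay with the one at
          \<open>N\<close>.\<close>
        using delay_on_arrival_mono[of n N] delay_on_arrival_mono[of N n] q
        unfolding eq[symmetric] p by auto
    qed
  next
    assume "\<forall>n \<le> N + 1.
      (p n = 0 \<longrightarrow> R / C \<le> delay n (n + 1)) \<and> (p n = 1 \<longrightarrow> delay n (n + 1) \<le> R / C) \<and>
      (0 < p n \<and> p n < 1 \<longrightarrow> delay n (n + 1) = R / C)"
    from this[rule_format, of N] show "delay N (N + 1) = R / C"
      using q by (simp add: p)
  qed
  finally show ?thesis
    unfolding p_def[symmetric] N_def[symmetric] W by simp
qed

end
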